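(* Let $G$ be a connected $r$-regular graph with $n$ vertices and $m$ edges. Let $G_1$ be an $r_1$-regular graph with $n_1$ vertices and $G_2$ an $r_2$-regular graph with $n_2$ vertices. Let $0=\mu_1(G),\mu_2(G),\ldots,\mu_n(G)$; $0=\eta_1(G_1),\eta_2(G_1),\ldots,\eta_{n_1}(G_1)$; and $0=\delta_1(G_2),\delta_2(G_2),\ldots,\delta_{n_2}(G_2)$ be the normalized Laplacian spectra of $G$, $G_1$ and $G_2$, respectively. Then the normalized Laplacian spectrum of the $R$-graph double corona $G^{(R)}\otimes\{G_1,G_2\}$ consists of: (1) the eigenvalue $\dfrac{1+r_1\eta_j(G_1)}{r_1+1}$ with multiplicity $n$, for every eigenvalue $\eta_j(G_1)$, $j=2,3,\dots,n_1$; (2) the eigenvalue $\dfrac{1+r_2\delta_k(G_2)}{r_2+1}$ with multiplicity $m$, for every eigenvalue $\delta_k(G_2)$, $k=2,3,\dots,n_2$; (3) for each eigenvalue $\mu_i(G)$, $i=1,2,\dots,n$, the four roots of the equation \[ \left[(x-1)(2+n_2)(xr_2+x-1)-n_2\right]\left[(x-1)(2r+n_1)(xr_1+x-1)+r(1-\mu_i(G))(xr_1+x-1)-n_1\right]-r(\mu_i(G)-2)(xr_1+x-1)(xr_2+x-1)=0; \] (4) the two roots of the equation $(x-1)(2+n_2)(xr_2+x-1)-n_2=0$, each with multiplicity $m-n$, if $m>n$.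
   Context: All graphs are finite and simple. For a graph $H$ with adjacency matrix $A(H)$ and diagonal degree matrix $D(H)$ (all degrees positive), the normalized Laplacian is $\mathcal{L}(H)=I-D(H)^{-1/2}A(H)D(H)^{-1/2}$; its normalized Laplacian spectrum is the multiset of eigenvalues of $\mathcal{L}(H)$. The $R$-graph $G^{(R)}$ of $G$ is obtained from $G$ by adding, for each edge of $G$, a new vertex and joining it to the two endpoints of that edge; the vertices of $G$ are called old vertices and the added ones new vertices. For a connected graph $G$ with $n$ vertices and $m$ edges and graphs $G_1$ (on $n_1$ vertices) and $G_2$ (on $n_2$ vertices), the $R$-graph double corona $G^{(R)}\otimes\{G_1,G_2\}$ is obtained by taking one copy of $G^{(R)}$, $n$ copies of $G_1$ and $m$ copies of $G_2$, and joining the $i$-th old vertex of $G^{(R)}$ to every vertex of the $i$-th copy of $G_1$, and the $j$-th new vertex of $G^{(R)}$ to every vertex of the $j$-th copy of $G_2$.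
   Formalization: In (3) the last term is +r(μ_i−2)(xr_1+x−1)(xr_2+x−1): with the printed minus sign the eigenvalue 0 never occurs. If m<n (only G=K_2), the list (1)–(3) is the spectrum together with n−m extra copies of the two roots in (4). *)

theory Defs
  imports
    "Graph_Theory.Graph_Theory"
    "Jordan_Normal_Form.Char_Poly"
begin

text \<open>
  A finite simple graph is a \<open>pair_graph\<close>: a finite symmetric loop-free digraph without parallel
  arcs. Each undirected edge \<open>{u, v}\<close> is represented by the two arcs \<open>(u, v)\<close> and \<open>(v, u)\<close>.
\<close>

definition edges :: "'a pair_pre_digraph \<Rightarrow> 'a set set" where
  "edges G = (\<lambda>(u, v). {u, v}) ` parcs G"

definition regular :: "'a pair_pre_digraph \<Rightarrow> nat \<Rightarrow> bool" where
  "regular G r \<longleftrightarrow> (\<forall>v \<in> pverts G. out_degree (with_proj G) v = r)"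


section \<open>Normalized Laplacian spectrum\<close>

text \<open>
  The matrices are indexed by positions in an enumeration of the vertices. Another enumeration
  permutes rows and columns simultaneously and so leaves the spectrum unchanged.
\<close>

definition vertex_list :: "'a pair_pre_digraph \<Rightarrow> 'a list" where
  "vertex_list G = (SOME vs. distinct vs \<and> set vs = pverts G)"

definition adjacency_matrix :: "'a pair_pre_digraph \<Rightarrow> real mat" where
  "adjacency_matrix G =
     (let vs = vertex_list G
      in mat (length vs) (length vs) (\<lambda>(i, j). if (vs ! i, vs ! j) \<in> parcs G then 1 else 0))"

text \<open>
  The matrix $D^{-1/2}$. It is meaningful only if all degrees are positive.
\<close>

definition inv_sqrt_degree_matrix :: "'a pair_pre_digraph \<Rightarrow> real mat" where
  "inv_sqrt_degree_matrix G =
     (let vs = vertex_list G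
      in mat_diag (length vs) (\<lambda>i. 1 / sqrt (real (out_degree (with_proj G) (vs ! i)))))"

definition normalized_laplacian :: "'a pair_pre_digraph \<Rightarrow> real mat" where
  "normalized_laplacian G =
     1\<^sub>m (length (vertex_list G)) -
     inv_sqrt_degree_matrix G * adjacency_matrix G * inv_sqrt_degree_matrix G"

text \<open>
  Eigenvalues are taken in the complex numbers with algebraic multiplicity. The matrix is real
  symmetric, so they are in fact real and the algebraic and geometric multiplicities agree.
\<close>

definition normalized_laplacian_spectrum :: "'a pair_pre_digraph \<Rightarrow> complex multiset" where
  "normalized_laplacian_spectrum G =
     proots (char_poly (map_mat complex_of_real (normalized_laplacian G)))"


section \<open>R-graph and R-graph double corona\<close>

text \<open>The new vertex added for an edge \<open>e\<close> is \<open>New e\<close>.\<close>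

datatype 'a r_vertex = Old 'a | New "'a set"

definition R_graph :: "'a pair_pre_digraph \<Rightarrow> 'a r_vertex pair_pre_digraph" where
  "R_graph G =
    \<lparr> pverts = Old ` pverts G \<union> New ` edges G,
      parcs = {(Old u, Old v) | u v. (u, v) \<in> parcs G}
            \<union> {(Old u, New e) | u e. e \<in> edges G \<and> u \<in> e}
            \<union> {(New e, Old u) | u e. e \<in> edges G \<and> u \<in> e} \<rparr>"

text \<open>
  \<open>Copy1 v a\<close> is the vertex \<open>a\<close> in the copy of \<open>G\<^sub>1\<close> that belongs to the old vertex \<open>v\<close>, and
  \<open>Copy2 e b\<close> is the vertex \<open>b\<close> in the copy of \<open>G\<^sub>2\<close> that belongs to the new vertex \<open>New e\<close>.
\<close>

datatype ('a, 'b, 'c) corona_vertex =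
  Base "'a r_vertex" | Copy1 'a 'b | Copy2 "'a set" 'c

definition R_graph_double_corona ::
  "'a pair_pre_digraph \<Rightarrow> 'b pair_pre_digraph \<Rightarrow> 'c pair_pre_digraph
    \<Rightarrow> ('a, 'b, 'c) corona_vertex pair_pre_digraph" where
  "R_graph_double_corona G G1 G2 =
    \<lparr> pverts = Base ` pverts (R_graph G)
             \<union> {Copy1 v a | v a. v \<in> pverts G \<and> a \<in> pverts G1}
             \<union> {Copy2 e b | e b. e \<in> edges G \<and> b \<in> pverts G2},
      parcs = {(Base x, Base y) | x y. (x, y) \<in> parcs (R_graph G)}
            \<union> {(Copy1 v a, Copy1 v a') | v a a'. v \<in> pverts G \<and> (a, a') \<in> parcs G1}
            \<union> {(Copy2 e b, Copy2 e b') | e b b'. e \<in> edges G \<and> (b, b') \<in> parcs G2}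
            \<union> {(Base (Old v), Copy1 v a) | v a. v \<in> pverts G \<and> a \<in> pverts G1}
            \<union> {(Copy1 v a, Base (Old v)) | v a. v \<in> pverts G \<and> a \<in> pverts G1}
            \<union> {(Base (New e), Copy2 e b) | e b. e \<in> edges G \<and> b \<in> pverts G2}
            \<union> {(Copy2 e b, Base (New e)) | e b. e \<in> edges G \<and> b \<in> pverts G2} \<rparr>"

lemma finite_edges: "finite (parcs G) \<Longrightarrow> finite (edges G)"
  by (simp add: edges_def)

lemma pair_graph_R_graph:
  assumes "pair_graph G"
  shows "pair_graph (R_graph G)"
proof -
  interpret pair_graph G by fact
  have fin: "finite (pverts (R_graph G))"
    by (simp add: R_graph_def finite_edges pair_finite_verts pair_finite_arcs)
  have wf: "parcs (R_graph G) \<subseteq> pverts (R_graph G) \<times> pverts (R_graph G)"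
    by (auto simp: R_graph_def edges_def dest: in_arcsD1 in_arcsD2)
  have sym: "sym (parcs (R_graph G))"
    using pair_sym_arcs by (auto simp: R_graph_def sym_def symmetric_def)
  have loopfree: "fst e \<noteq> snd e" if "e \<in> parcs (R_graph G)" for e
    using that by (auto simp: R_graph_def dest: pair_no_loops)
  show ?thesis
    by unfold_locales
      (use wf fin finite_subset[OF wf] sym loopfree in \<open>auto simp: symmetric_def\<close>)
qed

lemma pair_graph_R_graph_double_corona:
  assumes "pair_graph G" and "pair_graph G1" and "pair_graph G2"
  shows "pair_graph (R_graph_double_corona G G1 G2)" (is "pair_graph ?H")
proof -
  interpret G: pair_graph G by fact
  interpret R: pair_graph "R_graph G" by (rule pair_graph_R_graph) fact
  interpret G1: pair_graph G1 by fact
  interpret G2: pair_graph G2 by fact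
  have "pverts ?H = Base ` pverts (R_graph G)
      \<union> (\<lambda>(v, a). Copy1 v a) ` (pverts G \<times> pverts G1)
      \<union> (\<lambda>(e, b). Copy2 e b) ` (edges G \<times> pverts G2)"
    by (auto simp: R_graph_double_corona_def)
  then have fin: "finite (pverts ?H)"
    by (simp add: finite_edges G.pair_finite_verts G.pair_finite_arcs R.pair_finite_verts
        G1.pair_finite_verts G2.pair_finite_verts)
  have RV: "Old v \<in> pverts (R_graph G) \<longleftrightarrow> v \<in> pverts G"
    "New e \<in> pverts (R_graph G) \<longleftrightarrow> e \<in> edges G" for v e
    by (auto simp: R_graph_def)
  have wf: "parcs ?H \<subseteq> pverts ?H \<times> pverts ?H"
    by (auto simp: R_graph_double_corona_def RV
        dest: R.in_arcsD1 R.in_arcsD2 G1.in_arcsD1 G1.in_arcsD2 G2.in_arcsD1 G2.in_arcsD2)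
  have sym: "sym (parcs ?H)"
    using R.pair_sym_arcs G1.pair_sym_arcs G2.pair_sym_arcs
    by (auto simp: R_graph_double_corona_def sym_def symmetric_def)
  have loopfree: "fst e \<noteq> snd e" if "e \<in> parcs ?H" for e
    using that
    by (auto simp: R_graph_double_corona_def
        dest: R.pair_no_loops G1.pair_no_loops G2.pair_no_loops)
  show ?thesis
    by unfold_locales
      (use wf fin finite_subset[OF wf] sym loopfree in \<open>auto simp: symmetric_def\<close>)
qed

end

theory Submission
  imports Defs
begin

text \<open>
  Clearing denominators, the characteristic polynomial of the normalized Laplacian of a graph $H$
  is, up to the factor $\prod_v d_v$, the determinant of $(x-1)D + A$. For the double corona and all
  but finitely many $x$ one eliminates first the copies of $G_1$ and $G_2$, which works because the
  all-ones vector is an eigenvector of a regular graph, and then the new vertices, using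
  $BB^T = rI + A(G)$ for the incidence matrix $B$ of $G$. The remaining Schur complement is a linear
  polynomial in $A(G)$, so that its determinant is a product over the $\mu_i(G)$. Comparing
  polynomials and their roots gives the spectrum.
\<close>

section \<open>Determinants over finite index sets\<close>

text \<open>Each copy hangs on a single base vertex that is joined to all of its vertices, so the
  block coupling it to the rest is an indicator vector. The block of $(x-1)D + A$ on a copy maps
  this vector to \<open>q1 x\<close> or \<open>q2 x\<close> times itself, and the Schur complement
  sees the copy only through that number. Thus only the eigenvalue 0 of G1 and of G2 takes part: its
  factors \<open>q1 x\<close> and \<open>q2 x\<close> cancel denominators created by the
  elimination, and the eigenvalues from index 2 on survive as (1) and (2).

  The new vertices contribute \<open>P x ^ m\<close>, while clearing denominators at the n old
  vertices costs \<open>P x ^ n\<close>. Since n r = 2 m, the difference m - n is negative for r =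
  1. Hence the identity keeps \<open>P x ^ n\<close> on one side and \<open>P x ^ m\<close> on the
  other until it has become an equation of multisets, where common roots cancel.

  Determinants are indexed by finite sets because the vertex set of the corona is a disjoint union,
  while its enumeration is an arbitrary choice that need not respect the parts.\<close>

definition indexed_mat :: "'i list \<Rightarrow> ('i \<Rightarrow> 'i \<Rightarrow> 'a) \<Rightarrow> 'a mat" where
  "indexed_mat vs f = mat (length vs) (length vs) (\<lambda>(i, j). f (vs ! i) (vs ! j))"

lemma indexed_mat_carrier [simp]: "indexed_mat vs f \<in> carrier_mat (length vs) (length vs)"
  by (simp add: indexed_mat_def)

text \<open>The choice of the enumeration is harmless: reordering it permutes rows and columns
  simultaneously.\<close>

definition det_on :: "'i set \<Rightarrow> ('i \<Rightarrow> 'i \<Rightarrow> 'a :: comm_ring_1) \<Rightarrow> 'a" where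
  "det_on S f = det (indexed_mat (SOME vs. distinct vs \<and> set vs = S) f)"

text \<open>Rows and columns undergo the same permutation, so its sign enters twice and squares to
  1.\<close>

lemma det_indexed_mat_permute_list:
  fixes f :: "'i \<Rightarrow> 'i \<Rightarrow> 'a :: comm_ring_1"
  assumes p: "p permutes {..<length vs}"
  shows "det (indexed_mat (permute_list p vs) f) = det (indexed_mat vs f)"
proof -
  let ?n = "length vs"
  have p': "p permutes {0..<?n}"
    using p by (simp add: atLeast0LessThan)
  have bound: "p i < ?n" if "i < ?n" for i
    using p that by (simp add: permutes_in_image flip: lessThan_iff)
  \<comment> \<open>\<open>C\<close> has permuted columns but rows in the original order. It is one
    row permutation away from the left-hand matrix, and its transpose is one row permutation away
    from the transpose of the right-hand one.\<close>
  define C where "C = mat ?n ?n (\<lambda>(i, j). f (vs ! i) (vs ! p j))"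
  have C: "C \<in> carrier_mat ?n ?n"
    by (simp add: C_def)
  have "indexed_mat (permute_list p vs) f = mat ?n ?n (\<lambda>(i, j). C $$ (p i, j))"
    by (rule eq_matI) (auto simp: indexed_mat_def C_def permute_list_nth[OF p] bound)
  then have 1: "det (indexed_mat (permute_list p vs) f) = signof p * det C"
    using det_permute_rows[OF C p'] by simp
  have "transpose_mat C = mat ?n ?n (\<lambda>(i, j). transpose_mat (indexed_mat vs f) $$ (p i, j))"
    by (rule eq_matI) (auto simp: indexed_mat_def C_def bound)
  then have "det C = signof p * det (indexed_mat vs f)"
    using det_permute_rows[OF _ p', of "transpose_mat (indexed_mat vs f)"]
      det_transpose[OF C] det_transpose[OF indexed_mat_carrier, of vs f] by simp
  with 1 show ?thesis
    by (simp add: sign_def flip: mult.assoc)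
qed

text \<open>Two duplicate-free lists with the same elements have equal multisets and so differ by a
  permutation.\<close>

lemma det_on_list:
  assumes "distinct vs" "set vs = S"
  shows "det_on S f = det (indexed_mat vs f)"
proof -
  let ?ws = "SOME vs. distinct vs \<and> set vs = S"
  have "distinct ?ws \<and> set ?ws = S"
    by (rule someI[of _ vs]) (use assms in simp)
  then have "mset ?ws = mset vs"
    using assms by (metis set_eq_iff_mset_eq_distinct)
  then obtain p where "p permutes {..<length vs}" "permute_list p vs = ?ws"
    by (metis mset_eq_permutation)
  then show ?thesis
    unfolding det_on_def using det_indexed_mat_permute_list by metis
qed

lemma det_on_cong:
  assumes "finite S" "\<And>u v. u \<in> S \<Longrightarrow> v \<in> S \<Longrightarrow> f u v = g u v"
  shows "det_on S f = det_on S g"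
proof -
  obtain vs where vs: "distinct vs" "set vs = S"
    using finite_distinct_list[OF assms(1)] by auto
  have "indexed_mat vs f = indexed_mat vs g"
    by (rule eq_matI) (use vs assms(2) in \<open>auto simp: indexed_mat_def\<close>)
  then show ?thesis
    by (simp add: det_on_list[OF vs])
qed

lemma det_on_mult:
  assumes "finite S"
  shows "det_on S (\<lambda>u v. \<Sum>w\<in>S. f u w * g w v) = det_on S f * det_on S g"
proof -
  obtain vs where vs: "distinct vs" "set vs = S"
    using finite_distinct_list[OF assms(1)] by auto
  have sum: "(\<Sum>i = 0..<length vs. h (vs ! i)) = (\<Sum>w\<in>S. h w)" for h :: "'a \<Rightarrow> 'b"
    using sum_list_distinct_conv_sum_set[OF vs(1), of h] vs(2) by (simp add: sum_list_sum_nth)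
  have "indexed_mat vs (\<lambda>u v. \<Sum>w\<in>S. f u w * g w v) = indexed_mat vs f * indexed_mat vs g"
    by (rule eq_matI) (auto simp: indexed_mat_def scalar_prod_def sum[symmetric])
  then show ?thesis
    by (simp add: det_on_list[OF vs] det_mult[OF indexed_mat_carrier indexed_mat_carrier])
qed

lemma det_on_empty [simp]: "det_on {} f = 1"
  by (simp add: det_on_list[of "[]"] indexed_mat_def det_dim_zero)

lemma det_on_singleton [simp]: "det_on {a} f = f a a"
  by (simp add: det_on_list[of "[a]"] indexed_mat_def det_single)

lemma det_on_image:
  assumes "finite S" "inj_on h S"
  shows "det_on (h ` S) f = det_on S (\<lambda>u v. f (h u) (h v))"
proof -
  obtain vs where vs: "distinct vs" "set vs = S"
    using finite_distinct_list[OF assms(1)] by auto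
  have "indexed_mat (map h vs) f = indexed_mat vs (\<lambda>u v. f (h u) (h v))"
    by (rule eq_matI) (auto simp: indexed_mat_def)
  moreover have "distinct (map h vs)" "set (map h vs) = h ` S"
    using vs assms(2) by (auto simp: distinct_map)
  ultimately show ?thesis
    by (simp add: det_on_list[OF vs] det_on_list[of "map h vs"])
qed

lemma det_on_block_triangular:
  fixes f :: "'i \<Rightarrow> 'i \<Rightarrow> 'a :: idom"
  assumes "finite R" "finite T" "R \<inter> T = {}"
    and zero: "\<And>u v. u \<in> R \<Longrightarrow> v \<in> T \<Longrightarrow> f u v = 0"
  shows "det_on (R \<union> T) f = det_on R f * det_on T f"
proof -
  obtain rs where rs: "distinct rs" "set rs = R"
    using finite_distinct_list[OF assms(1)] by auto
  obtain ts where ts: "distinct ts" "set ts = T"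
    using finite_distinct_list[OF assms(2)] by auto
  let ?r = "length rs" and ?t = "length ts"
  have "indexed_mat (rs @ ts) f =
      four_block_mat (indexed_mat rs f) (0\<^sub>m ?r ?t)
        (mat ?t ?r (\<lambda>(i, j). f (ts ! i) (rs ! j))) (indexed_mat ts f)"
    by (rule eq_matI)
      (use rs ts zero in \<open>auto simp: indexed_mat_def four_block_mat_def nth_append Let_def\<close>)
  then have "det (indexed_mat (rs @ ts) f) = det (indexed_mat rs f) * det (indexed_mat ts f)"
    by (simp add: det_four_block_mat_upper_right_zero[where n = ?r and m = ?t])
  moreover have "distinct (rs @ ts)" "set (rs @ ts) = R \<union> T"
    using rs ts assms(3) by auto
  ultimately show ?thesis
    by (simp add: det_on_list[OF rs] det_on_list[OF ts] det_on_list[of "rs @ ts"])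
qed

lemma det_on_diagonal:
  fixes f :: "'i \<Rightarrow> 'i \<Rightarrow> 'a :: idom"
  assumes "finite S" "\<And>u v. u \<in> S \<Longrightarrow> v \<in> S \<Longrightarrow> u \<noteq> v \<Longrightarrow> f u v = 0"
  shows "det_on S f = (\<Prod>u\<in>S. f u u)"
  using assms
proof (induction S rule: finite_induct)
  case (insert a S)
  have "det_on ({a} \<union> S) f = det_on {a} f * det_on S f"
    by (rule det_on_block_triangular) (use insert in auto)
  with insert show ?case by simp
qed simp

lemma det_on_Sigma_block_diagonal:
  fixes f :: "'i \<times> 'j \<Rightarrow> 'i \<times> 'j \<Rightarrow> 'a :: idom"
  assumes "finite I" "finite S"
    and zero: "\<And>i j a b. i \<in> I \<Longrightarrow> j \<in> I \<Longrightarrow> a \<in> S \<Longrightarrow> b \<in> S \<Longrightarrow> i \<noteq> j \<Longrightarrow> f (i, a) (j, b) = 0"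
  shows "det_on (I \<times> S) f = (\<Prod>i\<in>I. det_on S (\<lambda>a b. f (i, a) (i, b)))"
  using assms(1,3)
proof (induction I rule: finite_induct)
  case (insert i I)
  have "insert i I \<times> S = Pair i ` S \<union> I \<times> S" by auto
  moreover have "det_on (Pair i ` S \<union> I \<times> S) f = det_on (Pair i ` S) f * det_on (I \<times> S) f"
    by (rule det_on_block_triangular) (use insert assms(2) in auto)
  moreover have "det_on (Pair i ` S) f = det_on S (\<lambda>a b. f (i, a) (i, b))"
    by (rule det_on_image) (auto simp: assms(2) inj_on_def)
  ultimately show ?case using insert by simp
qed simp

lemma det_on_scale_rows:
  fixes f :: "'i \<Rightarrow> 'i \<Rightarrow> 'a :: idom"
  assumes "finite S"
  shows "det_on S (\<lambda>u v. c u * f u v) = (\<Prod>u\<in>S. c u) * det_on S f"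
proof -
  let ?D = "\<lambda>u v. if u = v then c u else 0"
  have "det_on S (\<lambda>u v. c u * f u v) = det_on S (\<lambda>u v. \<Sum>w\<in>S. ?D u w * f w v)"
  proof (rule det_on_cong[OF assms])
    fix u v assume "u \<in> S"
    have "(\<Sum>w\<in>S. ?D u w * f w v) = (\<Sum>w\<in>S. if w = u then c u * f u v else 0)"
      by (rule sum.cong) auto
    then show "c u * f u v = (\<Sum>w\<in>S. ?D u w * f w v)"
      using \<open>u \<in> S\<close> assms by simp
  qed
  also have "\<dots> = det_on S ?D * det_on S f"
    by (rule det_on_mult) fact
  also have "det_on S ?D = (\<Prod>u\<in>S. c u)"
    by (subst det_on_diagonal) (use assms in auto)
  finally show ?thesis .
qed

lemma det_on_scale_columns:
  fixes f :: "'i \<Rightarrow> 'i \<Rightarrow> 'a :: idom"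
  assumes "finite S"
  shows "det_on S (\<lambda>u v. f u v * c v) = det_on S f * (\<Prod>u\<in>S. c u)"
proof -
  let ?D = "\<lambda>u v. if u = v then c u else 0"
  have "det_on S (\<lambda>u v. f u v * c v) = det_on S (\<lambda>u v. \<Sum>w\<in>S. f u w * ?D w v)"
  proof (rule det_on_cong[OF assms])
    fix u v assume "v \<in> S"
    have "(\<Sum>w\<in>S. f u w * ?D w v) = (\<Sum>w\<in>S. if w = v then f u v * c v else 0)"
      by (rule sum.cong) auto
    then show "f u v * c v = (\<Sum>w\<in>S. f u w * ?D w v)"
      using \<open>v \<in> S\<close> assms by simp
  qed
  also have "\<dots> = det_on S f * det_on S ?D"
    by (rule det_on_mult) fact
  also have "det_on S ?D = (\<Prod>u\<in>S. c u)"
    by (subst det_on_diagonal) (use assms in auto)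
  finally show ?thesis .
qed

text \<open>
  The premise on \<open>W\<close> says $f_{RT} + f_{RR} W = 0$, so that \<open>g\<close> is the Schur complement of the block
  $f_{RR}$; stating it with \<open>W\<close> avoids inverting that block.
\<close>

lemma det_on_eliminate:
  fixes f :: "'i \<Rightarrow> 'i \<Rightarrow> 'a :: idom"
  assumes fin: "finite R" "finite T" and disj: "R \<inter> T = {}"
    and zero: "\<And>u v. u \<in> R \<Longrightarrow> v \<in> T \<Longrightarrow> f u v + (\<Sum>w\<in>R. f u w * W w v) = 0"
    and g: "\<And>u v. u \<in> T \<Longrightarrow> v \<in> T \<Longrightarrow> f u v + (\<Sum>w\<in>R. f u w * W w v) = g u v"
  shows "det_on (R \<union> T) f = det_on R f * det_on T g"
proof -
  \<comment> \<open>Multiplying by \<open>U\<close> on the right adds to each column in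
    \<open>T\<close> the combination of the columns in \<open>R\<close> with coefficients
    \<open>W\<close>, which clears the block with rows \<open>R\<close> and columns
    \<open>T\<close>. \<open>U\<close> is unitriangular once \<open>T\<close> is listed before
    \<open>R\<close>, so this leaves the determinant unchanged.\<close>
  define U where "U u v = (if u = v then 1 else if u \<in> R \<and> v \<in> T then W u v else 0)" for u v
  define h where "h u v = (\<Sum>w\<in>R \<union> T. f u w * U w v)" for u v
  have "det_on (R \<union> T) U = det_on (T \<union> R) U"
    by (simp add: Un_commute)
  also have "\<dots> = det_on T U * det_on R U"
    by (rule det_on_block_triangular) (use fin disj in \<open>auto simp: U_def\<close>)
  also have "det_on T U = 1"
    by (subst det_on_diagonal) (use fin disj in \<open>auto simp: U_def\<close>)
  also have "det_on R U = 1"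
    by (subst det_on_diagonal) (use fin disj in \<open>auto simp: U_def\<close>)
  finally have "det_on (R \<union> T) U = 1" by simp
  then have 1: "det_on (R \<union> T) h = det_on (R \<union> T) f"
    using det_on_mult[of "R \<union> T" f U] fin by (simp add: h_def[abs_def])
  have split: "h u v = (\<Sum>w\<in>R. f u w * U w v) + (\<Sum>w\<in>T. f u w * U w v)" for u v
    unfolding h_def using fin disj by (rule sum.union_disjoint)
  have hT: "h u v = f u v + (\<Sum>w\<in>R. f u w * W w v)" if "v \<in> T" for u v
  proof -
    have "(\<Sum>w\<in>R. f u w * U w v) = (\<Sum>w\<in>R. f u w * W w v)"
      by (rule sum.cong) (use that disj in \<open>auto simp: U_def\<close>)
    moreover have "(\<Sum>w\<in>T. f u w * U w v) = (\<Sum>w\<in>T. if w = v then f u w else 0)"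
      by (rule sum.cong) (use that disj in \<open>auto simp: U_def\<close>)
    ultimately show ?thesis
      using that fin by (simp add: split add.commute)
  qed
  have hR: "h u v = f u v" if "v \<in> R" for u v
  proof -
    have "(\<Sum>w\<in>R. f u w * U w v) = (\<Sum>w\<in>R. if w = v then f u w else 0)"
      by (rule sum.cong) (use that disj in \<open>auto simp: U_def\<close>)
    moreover have "(\<Sum>w\<in>T. f u w * U w v) = 0"
      by (rule sum.neutral) (use that disj in \<open>auto simp: U_def\<close>)
    ultimately show ?thesis
      using that fin by (simp add: split)
  qed
  have "det_on (R \<union> T) h = det_on R h * det_on T h"
    by (rule det_on_block_triangular) (use fin disj zero in \<open>auto simp: hT\<close>)
  also have "det_on R h = det_on R f"
    by (rule det_on_cong) (auto simp: fin hR)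
  also have "det_on T h = det_on T g"
    by (rule det_on_cong) (auto simp: fin hT g)
  finally show ?thesis using 1 by simp
qed

section \<open>The normalized Laplacian as a determinant\<close>

definition adj :: "'a pair_pre_digraph \<Rightarrow> 'a \<Rightarrow> 'a \<Rightarrow> complex" where
  "adj G u v = of_bool ((u, v) \<in> parcs G)"

abbreviation deg :: "'a pair_pre_digraph \<Rightarrow> 'a \<Rightarrow> nat" where
  "deg G \<equiv> out_degree (with_proj G)"

lemma vertex_list:
  assumes "finite (pverts G)"
  shows "distinct (vertex_list G)" "set (vertex_list G) = pverts G"
proof -
  obtain vs where "distinct vs \<and> set vs = pverts G"
    using finite_distinct_list[OF assms] by auto
  then have "distinct (vertex_list G) \<and> set (vertex_list G) = pverts G"
    unfolding vertex_list_def by (rule someI)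
  then show "distinct (vertex_list G)" "set (vertex_list G) = pverts G" by auto
qed

lemma out_degree_eq_sum_adj:
  assumes "pair_graph G" "u \<in> pverts G"
  shows "of_nat (deg G u) = (\<Sum>v\<in>pverts G. adj G u v)"
proof -
  interpret pair_graph G by fact
  have "out_arcs (with_proj G) u = Pair u ` {v \<in> pverts G. (u, v) \<in> parcs G}"
    by (auto simp: out_arcs_def dest: in_arcsD2)
  then have "deg G u = card {v \<in> pverts G. (u, v) \<in> parcs G}"
    by (simp add: out_degree_def card_image inj_on_def)
  then show ?thesis
    by (simp add: adj_def of_bool_def sum.If_cases pair_finite_verts Int_def)
qed

lemma normalized_laplacian_carrier:
  assumes "finite (pverts G)"
  shows "map_mat complex_of_real (normalized_laplacian G)
    \<in> carrier_mat (card (pverts G)) (card (pverts G))"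
  using distinct_card[OF vertex_list(1)[OF assms]] vertex_list(2)[OF assms]
  by (auto simp: normalized_laplacian_def inv_sqrt_degree_matrix_def Let_def mat_diag_def)

text \<open>Since $xI - L = (x-1)I + D^{-1/2} A D^{-1/2}$, multiplying by $D^{1/2}$ on both sides
  removes all square roots. The two diagonal factors together contribute the product of the
  degrees.\<close>

lemma poly_char_poly_normalized_laplacian:
  assumes fin: "finite (pverts G)" and pos: "\<And>v. v \<in> pverts G \<Longrightarrow> deg G v > 0"
  shows "(\<Prod>v\<in>pverts G. of_nat (deg G v))
      * poly (char_poly (map_mat complex_of_real (normalized_laplacian G))) x
    = det_on (pverts G) (\<lambda>u v. (if u = v then (x - 1) * of_nat (deg G u) else 0) + adj G u v)"
proof -
  let ?vs = "vertex_list G"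
  let ?n = "length ?vs"
  let ?L = "map_mat complex_of_real (normalized_laplacian G)"
  define s where "s v = complex_of_real (sqrt (real (deg G v)))" for v
  have ss: "s v * s v = of_nat (deg G v)" for v
    unfolding s_def of_real_mult[symmetric] by simp
  have s0: "s v \<noteq> 0" if "v \<in> pverts G" for v
    using pos[OF that] by (simp add: s_def)
  define f where "f u v = (if u = v then x - 1 else 0) + adj G u v / (s u * s v)" for u v
  note vs = vertex_list[OF fin]
  have n: "?n = card (pverts G)"
    using vs distinct_card by metis
  have A: "adjacency_matrix G \<in> carrier_mat ?n ?n"
    by (simp add: adjacency_matrix_def Let_def)
  have L: "normalized_laplacian G = mat ?n ?n (\<lambda>(i, j). (if i = j then 1 else 0)
      - adjacency_matrix G $$ (i, j) / (sqrt (real (deg G (?vs ! i))) * sqrt (real (deg G (?vs ! j)))))"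
    unfolding normalized_laplacian_def inv_sqrt_degree_matrix_def Let_def mat_diag_mult_left[OF A]
    by (subst mat_diag_mult_right[of _ ?n ?n]) (auto intro!: eq_matI)
  have "- char_matrix ?L x = indexed_mat ?vs f"
  proof (rule eq_matI)
    fix i j
    assume "i < dim_row (indexed_mat ?vs f)" "j < dim_col (indexed_mat ?vs f)"
    then have ij: "i < ?n" "j < ?n"
      by (simp_all add: indexed_mat_def)
    have "?vs ! i = ?vs ! j \<longleftrightarrow> i = j"
      using ij vs by (simp add: nth_eq_iff_index_eq)
    then show "(- char_matrix ?L x) $$ (i, j) = indexed_mat ?vs f $$ (i, j)"
      using ij
      by (simp add: char_matrix_def L indexed_mat_def f_def s_def adjacency_matrix_def Let_def adj_def)
  qed (use normalized_laplacian_carrier[OF fin] n in \<open>auto simp: char_matrix_def indexed_mat_def\<close>)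
  then have "poly (char_poly ?L) x = det_on (pverts G) f"
    by (simp add: char_poly_matrix[OF normalized_laplacian_carrier[OF fin]] det_on_list[OF vs])
  then have "(\<Prod>v\<in>pverts G. of_nat (deg G v)) * poly (char_poly ?L) x
      = (\<Prod>v\<in>pverts G. s v) * det_on (pverts G) f * (\<Prod>v\<in>pverts G. s v)"
    by (simp add: ss[symmetric] prod.distrib)
  also have "\<dots> = det_on (pverts G) (\<lambda>u v. s u * f u v * s v)"
    by (simp add: det_on_scale_rows[OF fin] det_on_scale_columns[OF fin])
  also have "\<dots> = det_on (pverts G)
      (\<lambda>u v. (if u = v then (x - 1) * of_nat (deg G u) else 0) + adj G u v)"
    by (rule det_on_cong) (use fin s0 in \<open>auto simp: f_def ss[symmetric] field_simps\<close>)
  finally show ?thesis .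
qed

text \<open>A monic complex polynomial is the product of the linear factors of its root multiset,
  and the assumption lists this multiset with repetitions.\<close>

lemma poly_char_poly_spectrum:
  assumes "finite (pverts G)"
    and "normalized_laplacian_spectrum G = {# \<mu> i. i \<in># mset_set {1..n} #}"
  shows "poly (char_poly (map_mat complex_of_real (normalized_laplacian G))) x
    = (\<Prod>i = 1..n. x - \<mu> i)"
proof -
  let ?p = "char_poly (map_mat complex_of_real (normalized_laplacian G))"
  have "lead_coeff ?p = 1"
    using degree_monic_char_poly[OF normalized_laplacian_carrier[OF assms(1)]] by auto
  then have "?p = (\<Prod>z\<in>#proots ?p. [:- z, 1:])"
    using complex_poly_decompose_multiset[of ?p] by simp
  also have "\<dots> = (\<Prod>i = 1..n. [:- \<mu> i, 1:])"
    using assms(2)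
    by (simp add: normalized_laplacian_spectrum_def image_mset.compositionality comp_def
        flip: prod_unfold_prod_mset)
  finally show ?thesis
    by (simp add: poly_prod)
qed

text \<open>For an r-regular graph A = r (I - L), so the numbers r (1 - \<mu>_i) are the eigenvalues
  of A, and the determinant is that of tI + sA.\<close>

lemma det_on_shifted_adjacency:
  assumes fin: "finite (pverts G)" and reg: "regular G r" and "r > 0" and "n = card (pverts G)"
    and spec: "normalized_laplacian_spectrum G = {# \<mu> i. i \<in># mset_set {1..n} #}"
  shows "det_on (pverts G) (\<lambda>u v. (if u = v then t else 0) + s * adj G u v)
    = (\<Prod>i = 1..n. t + s * (of_nat r * (1 - \<mu> i)))"
\<comment> \<open>The value s = 0 cannot be discarded: the Schur complement on the old vertices has
  s = 1 - \<open>q2 x / P x\<close>, which may vanish.\<close>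
proof (cases "s = 0")
  case True
  then show ?thesis
    using assms(4) by (simp add: det_on_diagonal[OF fin])
next
  case False
  let ?r = "of_nat r :: complex"
  have deg: "deg G v = r" if "v \<in> pverts G" for v
    using reg that by (simp add: regular_def)
  \<comment> \<open>Chosen so that s (y - 1) r = t; the matrix is then s times $(y-1)D + A$.\<close>
  define y where "y = 1 + t / (s * ?r)"
  have "det_on (pverts G) (\<lambda>u v. (if u = v then t else 0) + s * adj G u v)
      = det_on (pverts G)
          (\<lambda>u v. s * ((if u = v then (y - 1) * of_nat (deg G u) else 0) + adj G u v))"
    by (rule det_on_cong) (use assms deg False in \<open>auto simp: y_def field_simps\<close>)
  also have "\<dots> = (\<Prod>v\<in>pverts G. s) * ((\<Prod>v\<in>pverts G. of_nat (deg G v)) * (\<Prod>i = 1..n. y - \<mu> i))"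
    using poly_char_poly_normalized_laplacian[of G y] fin \<open>r > 0\<close> deg
    by (simp add: poly_char_poly_spectrum[OF fin spec] det_on_scale_rows[OF fin])
  also have "\<dots> = (\<Prod>i = 1..n. s) * ((\<Prod>i = 1..n. ?r) * (\<Prod>i = 1..n. y - \<mu> i))"
    using assms(4) deg by simp
  also have "\<dots> = (\<Prod>i = 1..n. t + s * (?r * (1 - \<mu> i)))"
    unfolding prod.distrib[symmetric] using \<open>r > 0\<close> False
    by (intro prod.cong) (auto simp: y_def field_simps)
  finally show ?thesis .
qed

section \<open>Incidence of vertices and edges\<close>

definition inc :: "'a set \<Rightarrow> 'a \<Rightarrow> complex" where
  "inc e v = of_bool (v \<in> e)"

lemma pair_graph_finite:
  assumes "pair_graph G"
  shows "finite (pverts G)" "finite (edges G)"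
proof -
  interpret pair_graph G by fact
  show "finite (pverts G)" "finite (edges G)"
    by (simp_all add: pair_finite_verts finite_edges pair_finite_arcs)
qed

lemma pair_graph_adj_self:
  assumes "pair_graph G"
  shows "adj G u u = 0"
proof -
  interpret pair_graph G by fact
  show ?thesis
    using pair_no_loops by (force simp: adj_def)
qed

lemma sum_if_const: "(\<Sum>a\<in>A. if P then f a else 0) = (if P then sum f A else 0)"
  by simp

lemma edgeE:
  assumes "pair_graph G" "e \<in> edges G"
  obtains u v where "e = {u, v}" "u \<noteq> v" "u \<in> pverts G" "v \<in> pverts G" "(u, v) \<in> parcs G"
proof -
  interpret pair_graph G by fact
  from assms(2) obtain u v where uv: "(u, v) \<in> parcs G" "e = {u, v}"
    by (auto simp: edges_def)
  moreover have "u \<noteq> v"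
    using pair_no_loops[OF uv(1)] by simp
  ultimately show thesis
    using that in_arcsD1[OF uv(1)] in_arcsD2[OF uv(1)] by simp
qed

text \<open>An edge may come from either of its two arcs; symmetry of the arc set supplies the
  other.\<close>

lemma edge_iff_arc:
  assumes "pair_graph G"
  shows "{u, v} \<in> edges G \<longleftrightarrow> (u, v) \<in> parcs G"
proof -
  interpret pair_graph G by fact
  have "(v, u) \<in> parcs G \<Longrightarrow> (u, v) \<in> parcs G"
    using pair_sym_arcs by (auto simp: sym_def symmetric_def)
  then show ?thesis
    by (auto simp: edges_def doubleton_eq_iff image_iff)
qed

lemma sum_inc_edge:
  assumes "pair_graph G" "e \<in> edges G"
  shows "(\<Sum>v\<in>pverts G. inc e v) = 2"
proof -
  obtain u v where uv: "e = {u, v}" "u \<noteq> v" "u \<in> pverts G" "v \<in> pverts G"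
    using edgeE[OF assms] by metis
  have "pverts G \<inter> {w. w \<in> e} = {u, v}"
    using uv by auto
  then show ?thesis
    using uv pair_graph_finite[OF assms(1)] by (simp add: inc_def of_bool_def sum.If_cases)
qed

text \<open>This is $BB^T = D + A$ for the incidence matrix B. The sum counts the edges containing
  both u and v: the degree on the diagonal, where \<open>adj\<close> vanishes for lack of loops, and
  at most one edge off it.\<close>

lemma sum_inc_inc:
  assumes "pair_graph G" "u \<in> pverts G"
  shows "(\<Sum>e\<in>edges G. inc e u * inc e v) = (if u = v then of_nat (deg G u) else 0) + adj G u v"
proof -
  note fin = pair_graph_finite[OF assms(1)]
  have card: "(\<Sum>e\<in>edges G. inc e u * inc e v) = of_nat (card {e \<in> edges G. u \<in> e \<and> v \<in> e})"
    using fin by (simp add: inc_def of_bool_conj[symmetric] sum_of_bool_eq Int_def del: of_bool_conj)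
  show ?thesis
  proof (cases "u = v")
    case True
    \<comment> \<open>Edges at u correspond to neighbours of u by sending w to {u, w}, which turns
      the count into the out-degree.\<close>
    have "{e \<in> edges G. u \<in> e} = (\<lambda>w. {u, w}) ` {w \<in> pverts G. (u, w) \<in> parcs G}"
    proof (intro equalityI subsetI)
      fix e assume "e \<in> {e \<in> edges G. u \<in> e}"
      then obtain a b where "e = {a, b}" "a \<in> pverts G" "b \<in> pverts G" "u \<in> e" "e \<in> edges G"
        using edgeE[OF assms(1)] by blast
      \<comment> \<open>The endpoint of e other than u.\<close>
      moreover define w where "w = (if u = a then b else a)"
      ultimately have "e = {u, w}" "w \<in> pverts G" "{u, w} \<in> edges G"
        by (auto simp: insert_commute)
      then show "e \<in> (\<lambda>w. {u, w}) ` {w \<in> pverts G. (u, w) \<in> parcs G}"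
        using edge_iff_arc[OF assms(1)] by auto
    qed (use edge_iff_arc[OF assms(1)] in auto)
    moreover have "inj_on (\<lambda>w. {u, w}) {w \<in> pverts G. (u, w) \<in> parcs G}"
      by (auto simp: inj_on_def doubleton_eq_iff)
    ultimately have "card {e \<in> edges G. u \<in> e} = card {w \<in> pverts G. (u, w) \<in> parcs G}"
      by (simp add: card_image)
    also have "of_nat \<dots> = (\<Sum>w\<in>pverts G. adj G u w)"
      by (simp add: adj_def sum_of_bool_eq fin Int_def)
    also have "\<dots> = of_nat (deg G u)"
      using out_degree_eq_sum_adj[OF assms] by simp
    finally have "of_nat (card {e \<in> edges G. u \<in> e}) = (of_nat (deg G u) :: complex)" .
    then show ?thesis
      using True card pair_graph_adj_self[OF assms(1)] by simp
  next
    case False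
    have "{e \<in> edges G. u \<in> e \<and> v \<in> e} = (if (u, v) \<in> parcs G then {{u, v}} else {})"
    proof -
      have "e = {u, v}" if "e \<in> edges G" "u \<in> e" "v \<in> e" for e
        using edgeE[OF assms(1) that(1)] that(2,3) False by (metis doubleton_eq_iff insertE singletonD)
      then show ?thesis
        using edge_iff_arc[OF assms(1), of u v] by auto
    qed
    then show ?thesis
      using False card by (simp add: adj_def)
  qed
qed

section \<open>The double corona of regular graphs\<close>

locale regular_double_corona =
  fixes G :: "'a pair_pre_digraph" and G1 :: "'b pair_pre_digraph" and G2 :: "'c pair_pre_digraph"
    and r r1 r2 :: nat
  assumes G: "pair_graph G" and G1: "pair_graph G1" and G2: "pair_graph G2"
    and reg: "regular G r" and reg1: "regular G1 r1" and reg2: "regular G2 r2"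
    and pos: "r > 0" and pos1: "r1 > 0" and pos2: "r2 > 0"
begin

abbreviation "H \<equiv> R_graph_double_corona G G1 G2"
abbreviation "V \<equiv> pverts G"
abbreviation "E \<equiv> edges G"
abbreviation "V1 \<equiv> pverts G1"
abbreviation "V2 \<equiv> pverts G2"
abbreviation "old v \<equiv> Base (Old v) :: ('a, 'b, 'c) corona_vertex"
abbreviation "new e \<equiv> Base (New e) :: ('a, 'b, 'c) corona_vertex"
abbreviation "n \<equiv> card V"
abbreviation "m \<equiv> card E"
abbreviation "n1 \<equiv> card V1"
abbreviation "n2 \<equiv> card V2"

definition "C1 = (\<lambda>(v, a). Copy1 v a :: ('a, 'b, 'c) corona_vertex) ` (V \<times> V1)"
definition "C2 = (\<lambda>(e, b). Copy2 e b :: ('a, 'b, 'c) corona_vertex) ` (E \<times> V2)"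

lemma finites [simp]: "finite V" "finite E" "finite V1" "finite V2" "finite C1" "finite C2"
  by (simp_all add: C1_def C2_def pair_graph_finite G G1 G2)

lemma H: "pair_graph H"
  using G G1 G2 by (rule pair_graph_R_graph_double_corona)

text \<open>The unions are nested in the order of elimination, so that each step splits off the
  leftmost part.\<close>

lemma pverts_H: "pverts H = C1 \<union> (C2 \<union> (new ` E \<union> old ` V))"
  by (auto simp: R_graph_double_corona_def R_graph_def C1_def C2_def)

lemma sum_C1: "sum f C1 = (\<Sum>v\<in>V. \<Sum>a\<in>V1. f (Copy1 v a))"
  by (simp add: C1_def sum.reindex inj_on_def sum.cartesian_product case_prod_unfold)

lemma sum_C2: "sum f C2 = (\<Sum>e\<in>E. \<Sum>b\<in>V2. f (Copy2 e b))"
  by (simp add: C2_def sum.reindex inj_on_def sum.cartesian_product case_prod_unfold)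

lemma sum_new: "sum f (new ` E) = (\<Sum>e\<in>E. f (new e))"
  by (simp add: sum.reindex inj_on_def)

lemma sum_old: "sum f (old ` V) = (\<Sum>v\<in>V. f (old v))"
  by (simp add: sum.reindex inj_on_def)

lemma disjoints [simp]:
  "C1 \<inter> (C2 \<union> (new ` E \<union> old ` V)) = {}" "C2 \<inter> (new ` E \<union> old ` V) = {}"
  "new ` E \<inter> old ` V = {}"
  by (auto simp: C1_def C2_def)

lemma sum_pverts_H:
  fixes f :: "_ \<Rightarrow> complex"
  shows "sum f (pverts H) = (\<Sum>v\<in>V. \<Sum>a\<in>V1. f (Copy1 v a)) + ((\<Sum>e\<in>E. \<Sum>b\<in>V2. f (Copy2 e b))
    + ((\<Sum>e\<in>E. f (new e)) + (\<Sum>v\<in>V. f (old v))))"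
  by (simp add: pverts_H sum.union_disjoint sum_C1 sum_C2 sum_new sum_old)

lemma adj_H [simp]:
  "adj H (old u) (old v) = adj G u v"
  "u \<in> V \<Longrightarrow> e \<in> E \<Longrightarrow> adj H (old u) (new e) = inc e u"
  "u \<in> V \<Longrightarrow> e \<in> E \<Longrightarrow> adj H (new e) (old u) = inc e u"
  "adj H (new e) (new e') = 0"
  "u \<in> V \<Longrightarrow> a \<in> V1 \<Longrightarrow> adj H (old u) (Copy1 v a) = (if u = v then 1 else 0)"
  "u \<in> V \<Longrightarrow> a \<in> V1 \<Longrightarrow> adj H (Copy1 v a) (old u) = (if u = v then 1 else 0)"
  "adj H (old u) (Copy2 e b) = 0"
  "adj H (Copy2 e b) (old u) = 0"
  "adj H (new e) (Copy1 v a) = 0"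
  "adj H (Copy1 v a) (new e) = 0"
  "e \<in> E \<Longrightarrow> b \<in> V2 \<Longrightarrow> adj H (new e) (Copy2 e' b) = (if e = e' then 1 else 0)"
  "e \<in> E \<Longrightarrow> b \<in> V2 \<Longrightarrow> adj H (Copy2 e' b) (new e) = (if e = e' then 1 else 0)"
  "u \<in> V \<Longrightarrow> adj H (Copy1 u a) (Copy1 v a') = (if u = v then adj G1 a a' else 0)"
  "e \<in> E \<Longrightarrow> adj H (Copy2 e b) (Copy2 e' b') = (if e = e' then adj G2 b b' else 0)"
  "adj H (Copy1 u a) (Copy2 e b) = 0"
  "adj H (Copy2 e b) (Copy1 u a) = 0"
  by (auto simp: adj_def inc_def R_graph_double_corona_def R_graph_def)

lemma sum_adj: "u \<in> V \<Longrightarrow> (\<Sum>v\<in>V. adj G u v) = of_nat r"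
  using out_degree_eq_sum_adj[OF G] reg by (simp add: regular_def)

lemma sum_adj1: "u \<in> V1 \<Longrightarrow> (\<Sum>v\<in>V1. adj G1 u v) = of_nat r1"
  using out_degree_eq_sum_adj[OF G1] reg1 by (simp add: regular_def)

lemma sum_adj2: "u \<in> V2 \<Longrightarrow> (\<Sum>v\<in>V2. adj G2 u v) = of_nat r2"
  using out_degree_eq_sum_adj[OF G2] reg2 by (simp add: regular_def)

lemma sum_inc_inc': "u \<in> V \<Longrightarrow> (\<Sum>e\<in>E. inc e u * inc e v) = (if u = v then of_nat r else 0) + adj G u v"
  using sum_inc_inc[OF G] reg by (auto simp: regular_def)

lemma sum_inc: "u \<in> V \<Longrightarrow> (\<Sum>e\<in>E. inc e u) = of_nat r"
  using sum_inc_inc'[of u u] pair_graph_adj_self[OF G] by (simp add: inc_def)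

lemma in_pverts_H [simp]:
  "old v \<in> pverts H \<longleftrightarrow> v \<in> V" "new e \<in> pverts H \<longleftrightarrow> e \<in> E"
  "Copy1 v a \<in> pverts H \<longleftrightarrow> v \<in> V \<and> a \<in> V1" "Copy2 e b \<in> pverts H \<longleftrightarrow> e \<in> E \<and> b \<in> V2"
  by (auto simp: R_graph_double_corona_def R_graph_def)

text \<open>The degree r counts twice at an old vertex, for its neighbours in G and for the new
  vertices on its edges. A vertex of a copy gains one neighbour, its base vertex.\<close>

lemma deg_H:
  "v \<in> V \<Longrightarrow> deg H (old v) = 2 * r + n1"
  "e \<in> E \<Longrightarrow> deg H (new e) = 2 + n2"
  "v \<in> V \<Longrightarrow> a \<in> V1 \<Longrightarrow> deg H (Copy1 v a) = r1 + 1"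
  "e \<in> E \<Longrightarrow> b \<in> V2 \<Longrightarrow> deg H (Copy2 e b) = r2 + 1"
proof -
  have eqI: "deg H x = k" if "x \<in> pverts H" "(\<Sum>y\<in>pverts H. adj H x y) = of_nat k" for x k
    using out_degree_eq_sum_adj[OF H that(1)] that(2) by (simp only: of_nat_eq_iff)
  have mult_if: "c * (if P then 1 else 0) = (if P then c else 0)" for c :: complex and P
    by simp
  note sums = mult_if sum_pverts_H sum_if_const sum.delta sum.delta'
  show "deg H (old v) = 2 * r + n1" if "v \<in> V"
    by (rule eqI) (use that in \<open>simp_all add: sums sum_adj sum_inc\<close>)
  show "deg H (new e) = 2 + n2" if "e \<in> E"
    by (rule eqI) (use that in \<open>simp_all add: sums sum_inc_edge[OF G]\<close>)
  show "deg H (Copy1 v a) = r1 + 1" if "v \<in> V" "a \<in> V1"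
    by (rule eqI) (use that in \<open>simp_all add: sums sum_adj1\<close>)
  show "deg H (Copy2 e b) = r2 + 1" if "e \<in> E" "b \<in> V2"
    by (rule eqI) (use that in \<open>simp_all add: sums sum_adj2\<close>)
qed

section \<open>Elimination of the copies and of the new vertices\<close>

definition M :: "complex \<Rightarrow> ('a, 'b, 'c) corona_vertex \<Rightarrow> ('a, 'b, 'c) corona_vertex \<Rightarrow> complex" where
  "M x u v = (if u = v then (x - 1) * of_nat (deg H u) else 0) + adj H u v"

text \<open>The row sum of \<open>M x\<close> within one copy of G1: the diagonal entry (x - 1)(r1 +
  1) plus r1 ones. Likewise \<open>q2\<close> for G2.\<close>

definition q1 :: "complex \<Rightarrow> complex" where "q1 x = x * of_nat r1 + x - 1"
definition q2 :: "complex \<Rightarrow> complex" where "q2 x = x * of_nat r2 + x - 1"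
text \<open>Eliminating its copy of G2 leaves a new vertex with the diagonal entry (x - 1)(2 + n2) -
  n2 / \<open>q2 x\<close>, which is \<open>P x / q2 x\<close>.\<close>

definition P :: "complex \<Rightarrow> complex" where "P x = (x - 1) * (2 + of_nat n2) * q2 x - of_nat n2"

text \<open>The product of \<open>M x\<close> with the indicator vector of the copy at v. These are
  the only products needed, because the elimination coefficients are constant on each copy.\<close>

lemma sum_M_Copy1:
  assumes "v \<in> V"
  shows "u \<in> V \<Longrightarrow> a \<in> V1 \<Longrightarrow> (\<Sum>a'\<in>V1. M x (Copy1 u a) (Copy1 v a')) = (if u = v then q1 x else 0)"
    and "u \<in> V \<Longrightarrow> (\<Sum>a'\<in>V1. M x (old u) (Copy1 v a')) = (if u = v then of_nat n1 else 0)"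
    and "(\<Sum>a'\<in>V1. M x (new e) (Copy1 v a')) = 0"
    and "(\<Sum>a'\<in>V1. M x (Copy2 e b) (Copy1 v a')) = 0"
  using assms
  by (auto simp: M_def q1_def deg_H sum.distrib sum_adj1 algebra_simps)

lemma sum_M_Copy2:
  assumes "e \<in> E"
  shows "e' \<in> E \<Longrightarrow> b \<in> V2 \<Longrightarrow> (\<Sum>b'\<in>V2. M x (Copy2 e' b) (Copy2 e b')) = (if e' = e then q2 x else 0)"
    and "e' \<in> E \<Longrightarrow> (\<Sum>b'\<in>V2. M x (new e') (Copy2 e b')) = (if e' = e then of_nat n2 else 0)"
    and "(\<Sum>b'\<in>V2. M x (old u) (Copy2 e b')) = 0"
  using assms
  by (auto simp: M_def q2_def deg_H sum.distrib sum_adj2 algebra_simps)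

text \<open>An old vertex is coupled to its own copy only, by a vector of n1 ones, so the Schur
  complement changes nothing but its diagonal entry, by n1 / \<open>q1 x\<close>.\<close>

lemma det_eliminate_Copy1:
  assumes "q1 x \<noteq> 0"
  shows "det_on (pverts H) (M x) = det_on C1 (M x) * det_on (C2 \<union> (new ` E \<union> old ` V))
    (\<lambda>u v. M x u v - (if u = v \<and> u \<in> old ` V then of_nat n1 / q1 x else 0))"
proof -
  \<comment> \<open>The column at \<open>old u\<close> is -1 / \<open>q1 x\<close> times the
    indicator of the copy at u. The block on \<open>C1\<close> multiplies this indicator by
    \<open>q1 x\<close>, so the product cancels the coupling.\<close>
  define W where "W w v = (case w of Copy1 u a \<Rightarrow> if v = old u then - 1 / q1 x else 0 | _ \<Rightarrow> 0)"
    for w v :: "('a, 'b, 'c) corona_vertex"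
  have W: "(\<Sum>w\<in>C1. f w * W w (old v)) = - 1 / q1 x * (\<Sum>a\<in>V1. f (Copy1 v a))" if "v \<in> V" for f v
  proof -
    have "(\<Sum>w\<in>C1. f w * W w (old v))
        = (\<Sum>u\<in>V. if u = v then \<Sum>a\<in>V1. f (Copy1 v a) * (- 1 / q1 x) else 0)"
      unfolding sum_C1 by (rule sum.cong) (auto simp: W_def)
    then show ?thesis
      using that by (simp add: sum_distrib_left sum_divide_distrib)
  qed
  have W0: "(\<Sum>w\<in>C1. f w * W w v) = 0" if "\<And>u. v \<noteq> old u" for f v
    unfolding sum_C1 using that by (auto intro!: sum.neutral simp: W_def)
  show ?thesis
    unfolding pverts_H
  proof (rule det_on_eliminate[where W = W])
    fix z y assume "z \<in> C1" "y \<in> C2 \<union> (new ` E \<union> old ` V)"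
    then obtain u a where z: "z = Copy1 u a" "u \<in> V" "a \<in> V1" and "z \<noteq> y"
      by (auto simp: C1_def C2_def)
    then have "M x z y = adj H z y"
      by (simp add: M_def)
    with z \<open>y \<in> C2 \<union> (new ` E \<union> old ` V)\<close> show "M x z y + (\<Sum>w\<in>C1. M x z w * W w y) = 0"
      using assms by (auto simp: C2_def W W0 sum_M_Copy1)
  next
    fix z y assume "z \<in> C2 \<union> (new ` E \<union> old ` V)" "y \<in> C2 \<union> (new ` E \<union> old ` V)"
    then show "M x z y + (\<Sum>w\<in>C1. M x z w * W w y)
        = M x z y - (if z = y \<and> z \<in> old ` V then of_nat n1 / q1 x else 0)"
      using assms by (auto simp: C2_def W W0 sum_M_Copy1 split: if_splits)
  qed simp_all
qed

text \<open>The function \<open>k\<close> stands for the diagonal correction left by the preceding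
  elimination. Being supported on old vertices, it touches neither \<open>C2\<close> nor its
  coupling to the new vertices.\<close>

lemma det_eliminate_Copy2:
  assumes "q2 x \<noteq> 0" and k: "\<And>u. u \<notin> old ` V \<Longrightarrow> k u = 0"
  shows "det_on (C2 \<union> (new ` E \<union> old ` V)) (\<lambda>u v. M x u v - (if u = v then k u else 0))
    = det_on C2 (M x) * det_on (new ` E \<union> old ` V)
    (\<lambda>u v. M x u v - (if u = v then k u else 0)
       - (if u = v \<and> u \<in> new ` E then of_nat n2 / q2 x else 0))"
proof -
  define W where "W w v = (case w of Copy2 e b \<Rightarrow> if v = new e then - 1 / q2 x else 0 | _ \<Rightarrow> 0)"
    for w v :: "('a, 'b, 'c) corona_vertex"
  have W: "(\<Sum>w\<in>C2. f w * W w (new e)) = - 1 / q2 x * (\<Sum>b\<in>V2. f (Copy2 e b))" if "e \<in> E" for f e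
  proof -
    have "(\<Sum>w\<in>C2. f w * W w (new e))
        = (\<Sum>e'\<in>E. if e' = e then \<Sum>b\<in>V2. f (Copy2 e b) * (- 1 / q2 x) else 0)"
      unfolding sum_C2 by (rule sum.cong) (auto simp: W_def)
    then show ?thesis
      using that by (simp add: sum_distrib_left sum_divide_distrib)
  qed
  have W0: "(\<Sum>w\<in>C2. f w * W w v) = 0" if "\<And>e. v \<noteq> new e" for f v
    unfolding sum_C2 using that by (auto intro!: sum.neutral simp: W_def)
  let ?M = "\<lambda>u v. M x u v - (if u = v then k u else 0)"
  have sum0: "(\<Sum>w\<in>C2. ?M u w * W w v) = (\<Sum>w\<in>C2. M x u w * W w v)" for u v
    by (rule sum.cong) (use k in \<open>auto simp: C2_def\<close>)
  have "det_on (C2 \<union> (new ` E \<union> old ` V)) ?M = det_on C2 ?M * det_on (new ` E \<union> old ` V)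
      (\<lambda>u v. ?M u v - (if u = v \<and> u \<in> new ` E then of_nat n2 / q2 x else 0))"
  proof (rule det_on_eliminate[where W = W])
    fix z y assume "z \<in> C2" "y \<in> new ` E \<union> old ` V"
    then obtain e b where z: "z = Copy2 e b" "e \<in> E" "b \<in> V2" and "z \<noteq> y"
      by (auto simp: C2_def)
    then have "?M z y = adj H z y"
      by (simp add: M_def)
    with z \<open>y \<in> new ` E \<union> old ` V\<close> show "?M z y + (\<Sum>w\<in>C2. ?M z w * W w y) = 0"
      unfolding sum0 using assms(1) by (auto simp: W W0 sum_M_Copy2)
  next
    fix z y assume "z \<in> new ` E \<union> old ` V" "y \<in> new ` E \<union> old ` V"
    then show "?M z y + (\<Sum>w\<in>C2. ?M z w * W w y)
        = ?M z y - (if z = y \<and> z \<in> new ` E then of_nat n2 / q2 x else 0)"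
      unfolding sum0 using assms(1) by (auto simp: W W0 sum_M_Copy2 split: if_splits)
  qed simp_all
  also have "det_on C2 ?M = det_on C2 (M x)"
    by (rule det_on_cong) (use k in \<open>auto simp: C2_def\<close>)
  finally show ?thesis .
qed

text \<open>New vertices are pairwise non-adjacent, so their block is the scalar matrix with entry
  \<open>P x / q2 x\<close>. Its Schur complement subtracts \<open>q2 x / P x\<close> times $BB^T =
  rI + A(G)$, which stays linear in A(G).\<close>

lemma det_eliminate_new:
  assumes "q2 x \<noteq> 0" "P x \<noteq> 0"
    and kV: "\<And>v. v \<in> V \<Longrightarrow> k (old v) = k1"
    and kE: "\<And>e. e \<in> E \<Longrightarrow> k (new e) = of_nat n2 / q2 x"
  shows "det_on (new ` E \<union> old ` V) (\<lambda>u v. M x u v - (if u = v then k u else 0))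
    = (P x / q2 x) ^ m * det_on V (\<lambda>u v.
        (if u = v then (x - 1) * (2 * of_nat r + of_nat n1) - k1 - q2 x / P x * of_nat r else 0)
        + (1 - q2 x / P x) * adj G u v)"
proof -
  define c where "c = q2 x / P x"
  let ?M = "\<lambda>u v. M x u v - (if u = v then k u else 0)"
  define g where "g u v = (if u = v then (x - 1) * (2 * of_nat r + of_nat n1) - k1 - c * of_nat r else 0)
        + (1 - c) * adj G u v" for u v
  define un where "un z = (case z of Base (Old v) \<Rightarrow> v | _ \<Rightarrow> undefined)"
    for z :: "('a, 'b, 'c) corona_vertex"
  define W where "W w z = (case w of Base (New e) \<Rightarrow> - c * inc e (un z) | _ \<Rightarrow> 0)"
    for w z :: "('a, 'b, 'c) corona_vertex"
  have new: "?M (new e) (new e') = (if e = e' then P x / q2 x else 0)" if "e \<in> E" "e' \<in> E" for e e'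
    using assms that by (simp add: M_def deg_H P_def field_simps)
  have on: "?M (old u) (new e) = inc e u" "?M (new e) (old u) = inc e u" if "u \<in> V" "e \<in> E" for u e
    using that by (simp_all add: M_def)
  have W: "W (new e) (old v) = - c * inc e v" for e v
    by (simp add: W_def un_def)
  have cP: "P x / q2 x * c = 1"
    using assms by (simp add: c_def)
  have "det_on (new ` E \<union> old ` V) ?M = det_on (new ` E) ?M * det_on (old ` V) (\<lambda>z y. g (un z) (un y))"
  proof (rule det_on_eliminate[where W = W])
    fix z y assume "z \<in> new ` E" "y \<in> old ` V"
    then obtain e v where *: "z = new e" "e \<in> E" "y = old v" "v \<in> V" by auto
    have "(\<Sum>w\<in>new ` E. ?M z w * W w y) = (\<Sum>e'\<in>E. if e' = e then P x / q2 x * (- c * inc e v) else 0)"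
      unfolding sum_new * by (rule sum.cong) (use * in \<open>simp_all only: new W, auto\<close>)
    also have "\<dots> = - (P x / q2 x * c) * inc e v"
      using * by simp
    also have "\<dots> = - inc e v"
      unfolding cP by simp
    finally show "?M z y + (\<Sum>w\<in>new ` E. ?M z w * W w y) = 0"
      using * on by simp
  next
    fix z y assume "z \<in> old ` V" "y \<in> old ` V"
    then obtain u v where *: "z = old u" "u \<in> V" "y = old v" "v \<in> V" by auto
    have "(\<Sum>w\<in>new ` E. ?M z w * W w y) = (\<Sum>e\<in>E. - c * (inc e u * inc e v))"
      unfolding sum_new * by (rule sum.cong) (use * in \<open>simp_all only: on W, auto\<close>)
    also have "\<dots> = - c * (\<Sum>e\<in>E. inc e u * inc e v)"
      by (rule sum_distrib_left[symmetric])
    also have "\<dots> = - c * ((if u = v then of_nat r else 0) + adj G u v)"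
      using sum_inc_inc'[OF \<open>u \<in> V\<close>, of v] by simp
    finally have S: "(\<Sum>w\<in>new ` E. ?M z w * W w y) = - c * ((if u = v then of_nat r else 0) + adj G u v)" .
    show "?M z y + (\<Sum>w\<in>new ` E. ?M z w * W w y) = g (un z) (un y)"
      unfolding S using * by (simp add: M_def deg_H kV g_def un_def algebra_simps)
  qed simp_all
  also have "det_on (new ` E) ?M = (\<Prod>z\<in>new ` E. ?M z z)"
    by (rule det_on_diagonal) (auto simp: M_def)
  also have "\<dots> = (P x / q2 x) ^ m"
    using new[of e e for e] by (subst prod.reindex) (auto simp: inj_on_def)
  also have "det_on (old ` V) (\<lambda>z y. g (un z) (un y)) = det_on V g"
    by (subst det_on_image) (auto simp: inj_on_def un_def)
  finally show ?thesis
    unfolding g_def[abs_def] c_def .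
qed

text \<open>Different copies are not adjacent, so the block on \<open>C1\<close> consists of n equal
  diagonal blocks. Their diagonal carries r1 + 1 instead of r1, which makes them shifted adjacency
  matrices and turns \<eta> into (1 + r1 \<eta>) / (r1 + 1) at the level of roots.\<close>

lemma det_C1:
  "det_on C1 (M x) = det_on V1 (\<lambda>a b. (if a = b then (x - 1) * (of_nat r1 + 1) else 0) + adj G1 a b) ^ n"
proof -
  have "det_on C1 (M x) = det_on (V \<times> V1) (\<lambda>p p'. M x (case_prod Copy1 p) (case_prod Copy1 p'))"
    unfolding C1_def by (subst det_on_image) (auto simp: inj_on_def)
  also have "\<dots> = (\<Prod>v\<in>V. det_on V1 (\<lambda>a b. M x (Copy1 v a) (Copy1 v b)))"
    by (subst det_on_Sigma_block_diagonal) (auto simp: M_def)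
  also have "\<dots> = (\<Prod>v\<in>V. det_on V1 (\<lambda>a b. (if a = b then (x - 1) * (of_nat r1 + 1) else 0) + adj G1 a b))"
    by (intro prod.cong det_on_cong) (auto simp: M_def deg_H add.commute)
  finally show ?thesis by simp
qed

lemma det_C2:
  "det_on C2 (M x) = det_on V2 (\<lambda>a b. (if a = b then (x - 1) * (of_nat r2 + 1) else 0) + adj G2 a b) ^ m"
proof -
  have "det_on C2 (M x) = det_on (E \<times> V2) (\<lambda>p p'. M x (case_prod Copy2 p) (case_prod Copy2 p'))"
    unfolding C2_def by (subst det_on_image) (auto simp: inj_on_def)
  also have "\<dots> = (\<Prod>e\<in>E. det_on V2 (\<lambda>a b. M x (Copy2 e a) (Copy2 e b)))"
    by (subst det_on_Sigma_block_diagonal) (auto simp: M_def)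
  also have "\<dots> = (\<Prod>e\<in>E. det_on V2 (\<lambda>a b. (if a = b then (x - 1) * (of_nat r2 + 1) else 0) + adj G2 a b))"
    by (intro prod.cong det_on_cong) (auto simp: M_def deg_H add.commute)
  finally show ?thesis by simp
qed

text \<open>The factor \<open>P x ^ n\<close> on the left clears the denominator \<open>P x\<close>
  in each of the n factors belonging to G; the denominators \<open>q1 x\<close> there are cleared by
  the copies of G1. The right-hand side is thus polynomial in x.\<close>

lemma poly_char_poly_corona:
  fixes \<mu> \<eta> \<delta> :: "nat \<Rightarrow> complex"
  assumes spec: "normalized_laplacian_spectrum G = {# \<mu> i. i \<in># mset_set {1..n} #}"
    and spec1: "normalized_laplacian_spectrum G1 = {# \<eta> j. j \<in># mset_set {1..n1} #}"
    and spec2: "normalized_laplacian_spectrum G2 = {# \<delta> k. k \<in># mset_set {1..n2} #}"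
    and ne: "V1 \<noteq> {}" "V2 \<noteq> {}" and "\<eta> 1 = 0" "\<delta> 1 = 0"
    and nz: "q1 x \<noteq> 0" "q2 x \<noteq> 0" "P x \<noteq> 0"
  shows "(\<Prod>v\<in>pverts H. of_nat (deg H v))
      * poly (char_poly (map_mat complex_of_real (normalized_laplacian H))) x * P x ^ n
    = (\<Prod>j = 2..n1. q1 x - of_nat r1 * \<eta> j) ^ n * (\<Prod>k = 2..n2. q2 x - of_nat r2 * \<delta> k) ^ m
      * P x ^ m * (\<Prod>i = 1..n. P x * ((x - 1) * (2 * of_nat r + of_nat n1) * q1 x
          + of_nat r * (1 - \<mu> i) * q1 x - of_nat n1)
        + of_nat r * (\<mu> i - 2) * q1 x * q2 x)"
    (is "_ = ?A1 ^ n * ?A2 ^ m * _ * (\<Prod>i = 1..n. ?F i)")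
proof -
  \<comment> \<open>The diagonal corrections accumulated after the first and the second elimination,
    in the shape that the next one expects.\<close>
  let ?k = "\<lambda>u :: ('a, 'b, 'c) corona_vertex. if u \<in> old ` V then of_nat n1 / q1 x else 0"
  let ?k' = "\<lambda>u :: ('a, 'b, 'c) corona_vertex. ?k u + (if u \<in> new ` E then of_nat n2 / q2 x else 0)"
  define t where "t = (x - 1) * (2 * of_nat r + of_nat n1) - of_nat n1 / q1 x - q2 x / P x * of_nat r"
  define s where "s = 1 - q2 x / P x"
  have card: "1 \<le> n1" "1 \<le> n2"
    using ne by (simp_all add: Suc_le_eq card_gt_0_iff)
  have "det_on V1 (\<lambda>a b. (if a = b then (x - 1) * (of_nat r1 + 1) else 0) + adj G1 a b)
      = (\<Prod>j = 1..n1. (x - 1) * (of_nat r1 + 1) + of_nat r1 * (1 - \<eta> j))"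
    using det_on_shifted_adjacency[OF _ reg1 pos1 refl spec1, where s = 1] by simp
  also have "\<dots> = (\<Prod>j = 1..n1. q1 x - of_nat r1 * \<eta> j)"
    by (rule prod.cong) (simp_all add: q1_def algebra_simps)
  \<comment> \<open>The factor for \<eta>_1 = 0 is \<open>q1 x\<close> itself. It is split off here
    because it is consumed as a denominator below.\<close>
  also have "\<dots> = q1 x * ?A1"
    using card(1) \<open>\<eta> 1 = 0\<close> by (simp add: prod.atLeast_Suc_atMost numeral_2_eq_2)
  finally have 1: "det_on C1 (M x) = (q1 x * ?A1) ^ n"
    by (simp only: det_C1)
  have "det_on V2 (\<lambda>a b. (if a = b then (x - 1) * (of_nat r2 + 1) else 0) + adj G2 a b)
      = (\<Prod>k = 1..n2. (x - 1) * (of_nat r2 + 1) + of_nat r2 * (1 - \<delta> k))"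
    using det_on_shifted_adjacency[OF _ reg2 pos2 refl spec2, where s = 1] by simp
  also have "\<dots> = (\<Prod>k = 1..n2. q2 x - of_nat r2 * \<delta> k)"
    by (rule prod.cong) (simp_all add: q2_def algebra_simps)
  also have "\<dots> = q2 x * ?A2"
    using card(2) \<open>\<delta> 1 = 0\<close> by (simp add: prod.atLeast_Suc_atMost numeral_2_eq_2)
  finally have 2: "det_on C2 (M x) = (q2 x * ?A2) ^ m"
    by (simp only: det_C2)
  have 3: "det_on V (\<lambda>u v. (if u = v then t else 0) + s * adj G u v)
      = (\<Prod>i = 1..n. t + s * (of_nat r * (1 - \<mu> i)))"
    by (rule det_on_shifted_adjacency[OF _ reg pos refl spec]) simp
  \<comment> \<open>Clearing denominators in the eigenvalue of the last Schur complement that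
    belongs to \<mu>_i produces the quartic of (3).\<close>
  have F: "q1 x * P x * (t + s * (of_nat r * (1 - \<mu> i))) = ?F i" for i
    using nz by (simp add: t_def s_def field_simps)
  have "(\<Prod>v\<in>pverts H. of_nat (deg H v))
      * poly (char_poly (map_mat complex_of_real (normalized_laplacian H))) x = det_on (pverts H) (M x)"
    unfolding M_def[abs_def]
    by (rule poly_char_poly_normalized_laplacian)
      (auto simp: pverts_H C1_def C2_def deg_H pos)
  also have "\<dots> = det_on C1 (M x) * det_on (C2 \<union> (new ` E \<union> old ` V))
      (\<lambda>u v. M x u v - (if u = v then ?k u else 0))"
    unfolding det_eliminate_Copy1[OF nz(1)]
    by (intro arg_cong2[where f = "(*)"] det_on_cong refl) auto
  also have "\<dots> = det_on C1 (M x) * (det_on C2 (M x) * det_on (new ` E \<union> old ` V)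
      (\<lambda>u v. M x u v - (if u = v then ?k' u else 0)))"
    by (subst det_eliminate_Copy2[OF nz(2)])
      (auto intro!: arg_cong2[where f = "(*)"] det_on_cong)
  also have "det_on (new ` E \<union> old ` V) (\<lambda>u v. M x u v - (if u = v then ?k' u else 0))
      = (P x / q2 x) ^ m * (\<Prod>i = 1..n. t + s * (of_nat r * (1 - \<mu> i)))"
    unfolding 3[symmetric] unfolding t_def s_def
    by (rule det_eliminate_new[OF nz(2,3)]) auto
  finally have "(\<Prod>v\<in>pverts H. of_nat (deg H v))
      * poly (char_poly (map_mat complex_of_real (normalized_laplacian H))) x * P x ^ n
    = ?A1 ^ n * ?A2 ^ m * P x ^ m
      * ((q1 x * P x) ^ n * (\<Prod>i = 1..n. t + s * (of_nat r * (1 - \<mu> i))))"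
    using nz by (simp add: 1 2 power_mult_distrib power_divide)
  also have "(q1 x * P x) ^ n * (\<Prod>i = 1..n. t + s * (of_nat r * (1 - \<mu> i))) = (\<Prod>i = 1..n. ?F i)"
    unfolding F[symmetric] by (simp only: prod.distrib) (simp add: power_mult_distrib)
  finally show ?thesis .
qed

end

section \<open>From values of polynomials to multisets of roots\<close>

text \<open>The product p (a - b) vanishes at every point, hence is the zero polynomial in
  characteristic 0. This removes the finitely many points at which the elimination divides by
  zero.\<close>

lemma poly_eq_off_roots:
  fixes p a b :: "'a :: {idom, ring_char_0} poly"
  assumes "p \<noteq> 0" and eq: "\<And>x. poly p x \<noteq> 0 \<Longrightarrow> poly a x = poly b x"
  shows "a = b"
proof -
  have "\<forall>x. poly (p * (a - b)) x = 0"
    using eq by auto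
  then have "p * (a - b) = 0"
    by (simp only: poly_all_0_iff_0)
  then show ?thesis
    using assms(1) by simp
qed

lemma proots_linear_power:
  fixes c d :: "'a :: field"
  assumes "d \<noteq> 0"
  shows "proots ([:- c, d:] ^ n) = replicate_mset n (c / d)"
proof -
  have "proots [:- c, d:] = {#c / d#}"
    using proots_smult[OF assms, of "[:- (c / d), 1:]"] assms by simp
  then show ?thesis
    by (simp add: proots_power multiset_eq_iff)
qed

theorem theorem2p3:
  fixes G :: "'a pair_pre_digraph" and G1 :: "'b pair_pre_digraph" and G2 :: "'c pair_pre_digraph"
    and r r1 r2 n m n1 n2 :: nat
    and \<mu> \<eta> \<delta> :: "nat \<Rightarrow> complex"
  assumes "pair_graph G" and "Digraph_Component.connected (with_proj G)"
    and "regular G r" and "r > 0"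
    and "n = card (pverts G)" and "m = card (edges G)"
    and "pair_graph G1" and "pverts G1 \<noteq> {}" and "regular G1 r1" and "r1 > 0"
    and "n1 = card (pverts G1)"
    and "pair_graph G2" and "pverts G2 \<noteq> {}" and "regular G2 r2" and "r2 > 0"
    and "n2 = card (pverts G2)"
    and "normalized_laplacian_spectrum G = {# \<mu> i. i \<in># mset_set {1..n} #}" and "\<mu> 1 = 0"
    and "normalized_laplacian_spectrum G1 = {# \<eta> j. j \<in># mset_set {1..n1} #}" and "\<eta> 1 = 0"
    and "normalized_laplacian_spectrum G2 = {# \<delta> k. k \<in># mset_set {1..n2} #}" and "\<delta> 1 = 0"
  shows
    "let x = [:0, 1:] :: complex poly;
         spec = normalized_laplacian_spectrum (R_graph_double_corona G G1 G2);
         part1 = (\<Sum>j = 2..n1. replicate_mset n ((1 + of_nat r1 * \<eta> j) / (of_nat r1 + 1)));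
         part2 = (\<Sum>k = 2..n2. replicate_mset m ((1 + of_nat r2 * \<delta> k) / (of_nat r2 + 1)));
         part3 = (\<Sum>i = 1..n. proots (
           ((x - 1) * (2 + of_nat n2) * (x * of_nat r2 + x - 1) - of_nat n2) *
           ((x - 1) * (2 * of_nat r + of_nat n1) * (x * of_nat r1 + x - 1)
             + of_nat r * (1 - [:\<mu> i:]) * (x * of_nat r1 + x - 1) - of_nat n1)
           + of_nat r * ([:\<mu> i:] - 2) * (x * of_nat r1 + x - 1) * (x * of_nat r2 + x - 1)));
         roots4 = proots ((x - 1) * (2 + of_nat n2) * (x * of_nat r2 + x - 1) - of_nat n2)
     in (n \<le> m \<longrightarrow> spec = part1 + part2 + part3 + repeat_mset (m - n) roots4)
      \<and> (m < n \<longrightarrow> spec + repeat_mset (n - m) roots4 = part1 + part2 + part3)"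
proof -
  interpret C: regular_double_corona G G1 G2 r r1 r2
    by (rule regular_double_corona.intro) (fact assms)+
  note cards = assms(5,6,11,16)
  define X where "X = ([:0, 1:] :: complex poly)"
  define N where "N = char_poly (map_mat complex_of_real (normalized_laplacian C.H))"
  define K where "K = (\<Prod>v\<in>pverts C.H. of_nat (deg C.H v) :: complex)"
  define Q1 where "Q1 = X * of_nat r1 + X - 1"
  define Q2 where "Q2 = X * of_nat r2 + X - 1"
  define PP where "PP = (X - 1) * (2 + of_nat n2) * Q2 - of_nat n2"
  define F where "F i = PP * ((X - 1) * (2 * of_nat r + of_nat n1) * Q1
      + of_nat r * (1 - [:\<mu> i:]) * Q1 - of_nat n1) + of_nat r * ([:\<mu> i:] - 2) * Q1 * Q2" for i
  define A1 where "A1 j = [:- (1 + of_nat r1 * \<eta> j), of_nat r1 + 1:]" for j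
  define A2 where "A2 k = [:- (1 + of_nat r2 * \<delta> k), of_nat r2 + 1:]" for k

  have polys: "poly Q1 x = C.q1 x" "poly Q2 x = C.q2 x" "poly PP x = C.P x"
    "poly (A1 j) x = C.q1 x - of_nat r1 * \<eta> j" "poly (A2 k) x = C.q2 x - of_nat r2 * \<delta> k"
    "poly (F i) x = C.P x * ((x - 1) * (2 * of_nat r + of_nat n1) * C.q1 x
          + of_nat r * (1 - \<mu> i) * C.q1 x - of_nat n1)
        + of_nat r * (\<mu> i - 2) * C.q1 x * C.q2 x" for x i j k
    by (simp_all add: Q1_def Q2_def PP_def A1_def A2_def F_def X_def C.q1_def C.q2_def C.P_def cards
        algebra_simps)

  \<comment> \<open>At 0 both \<open>Q1\<close> and \<open>Q2\<close> take the value -1 and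
    \<open>PP\<close> takes the value 2.\<close>
  have "poly (Q1 * Q2 * PP) 0 \<noteq> 0"
    by (simp add: polys C.q1_def C.q2_def C.P_def)
  then have "Q1 * Q2 * PP \<noteq> 0"
    by (metis poly_0)
  moreover have "poly (Polynomial.smult K N * PP ^ n) x
      = poly ((\<Prod>j = 2..n1. A1 j ^ n) * (\<Prod>k = 2..n2. A2 k ^ m) * PP ^ m * (\<Prod>i = 1..n. F i)) x"
    if "poly (Q1 * Q2 * PP) x \<noteq> 0" for x
    using C.poly_char_poly_corona[folded cards, OF assms(17,19,21,8,13,20,22), of x] that
    by (simp add: polys poly_prod N_def K_def prod_power_distrib mult.assoc)
  ultimately have main: "Polynomial.smult K N * PP ^ n
      = (\<Prod>j = 2..n1. A1 j ^ n) * (\<Prod>k = 2..n2. A2 k ^ m) * PP ^ m * (\<Prod>i = 1..n. F i)"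
    by (rule poly_eq_off_roots)

  have "finite (pverts C.H)"
    by (rule pair_graph_finite[OF C.H])
  then have "N \<noteq> 0"
    using degree_monic_char_poly[OF normalized_laplacian_carrier] unfolding N_def by fastforce
  moreover have "K \<noteq> 0"
    using \<open>finite (pverts C.H)\<close> assms(4) by (auto simp: K_def C.pverts_H C.C1_def C.C2_def C.deg_H)
  moreover have "PP \<noteq> 0"
    using \<open>Q1 * Q2 * PP \<noteq> 0\<close> by auto
  ultimately have nz: "N \<noteq> 0" "K \<noteq> 0" "PP \<noteq> 0" "Polynomial.smult K N * PP ^ n \<noteq> 0"
    by auto
  \<comment> \<open>Root multisets add up only for nonzero factors. The nonzero left-hand side of
    \<open>main\<close> yields this for all factors at once, without inspecting the coefficients of
    \<open>F i\<close>.\<close>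
  then have nz': "(\<Prod>j = 2..n1. A1 j ^ n) \<noteq> 0" "(\<Prod>k = 2..n2. A2 k ^ m) \<noteq> 0" "(\<Prod>i = 1..n. F i) \<noteq> 0"
    unfolding main by auto

  have "1 + of_nat k \<noteq> (0 :: complex)" for k
    using of_nat_neq_0[of k, where 'a = complex] by simp
  then have proots1: "proots (A1 j ^ l) = replicate_mset l ((1 + of_nat r1 * \<eta> j) / (of_nat r1 + 1))"
    and proots2: "proots (A2 k ^ l) = replicate_mset l ((1 + of_nat r2 * \<delta> k) / (of_nat r2 + 1))" for j k l
    unfolding A1_def A2_def by (simp_all only: proots_linear_power add.commute not_False_eq_True)
  have part1: "proots (\<Prod>j = 2..n1. A1 j ^ n)
      = (\<Sum>j = 2..n1. replicate_mset n ((1 + of_nat r1 * \<eta> j) / (of_nat r1 + 1)))"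
    using nz'(1) by (subst proots_prod) (auto simp: proots1)
  have part2: "proots (\<Prod>k = 2..n2. A2 k ^ m)
      = (\<Sum>k = 2..n2. replicate_mset m ((1 + of_nat r2 * \<delta> k) / (of_nat r2 + 1)))"
    using nz'(2) by (subst proots_prod) (auto simp: proots2)
  have part3: "proots (\<Prod>i = 1..n. F i) = (\<Sum>i = 1..n. proots (F i))"
    using nz'(3) by (subst proots_prod) auto

  \<comment> \<open>Taking roots of \<open>main\<close> loses the constant \<open>K\<close> and
    turns the two powers of \<open>PP\<close> into multiples of the same root multiset.\<close>
  have "proots N + repeat_mset n (proots PP) = proots (Polynomial.smult K N * PP ^ n)"
    using nz by (simp add: proots_mult proots_power)
  also have "\<dots> = (\<Sum>j = 2..n1. replicate_mset n ((1 + of_nat r1 * \<eta> j) / (of_nat r1 + 1)))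
      + (\<Sum>k = 2..n2. replicate_mset m ((1 + of_nat r2 * \<delta> k) / (of_nat r2 + 1)))
      + (\<Sum>i = 1..n. proots (F i)) + repeat_mset m (proots PP)"
    unfolding main using nz nz'
    by (simp add: proots_mult proots_power part1 part2 part3 add_ac del: One_nat_def)
  finally have roots: "proots N + repeat_mset n (proots PP)
      = (\<Sum>j = 2..n1. replicate_mset n ((1 + of_nat r1 * \<eta> j) / (of_nat r1 + 1)))
      + (\<Sum>k = 2..n2. replicate_mset m ((1 + of_nat r2 * \<delta> k) / (of_nat r2 + 1)))
      + (\<Sum>i = 1..n. proots (F i)) + repeat_mset m (proots PP)"
    (is "_ = ?parts + _") .

  \<comment> \<open>The n common copies of the roots of \<open>PP\<close> cancel.\<close>
  have "proots N = ?parts + repeat_mset (m - n) (proots PP)" if "n \<le> m"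
  proof -
    have "repeat_mset m (proots PP) = repeat_mset (m - n) (proots PP) + repeat_mset n (proots PP)"
      using that by (simp flip: repeat_mset_distrib)
    then have "proots N + repeat_mset n (proots PP)
        = ?parts + repeat_mset (m - n) (proots PP) + repeat_mset n (proots PP)"
      using roots by (simp only: add.assoc)
    then show ?thesis
      by (simp only: add_right_cancel)
  qed
  \<comment> \<open>Now the surplus roots of \<open>PP\<close> lie on the side of the spectrum.
    Keeping them there as a summand avoids truncated subtraction of multisets.\<close>
  moreover have "proots N + repeat_mset (n - m) (proots PP) = ?parts" if "m < n"
  proof -
    have "repeat_mset n (proots PP) = repeat_mset (n - m) (proots PP) + repeat_mset m (proots PP)"
      using that by (simp flip: repeat_mset_distrib)
    then have "proots N + repeat_mset (n - m) (proots PP) + repeat_mset m (proots PP)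
        = ?parts + repeat_mset m (proots PP)"
      using roots by (simp only: add.assoc)
    then show ?thesis
      by (simp only: add_right_cancel)
  qed
  ultimately show ?thesis
    unfolding Let_def normalized_laplacian_spectrum_def F_def PP_def Q1_def Q2_def X_def N_def
    by blast
qed

end
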